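(* Let $k\ge 1$, let $g\in\mathbb{R}_k^+$, and let $G(x)=g(x^2)+xg(x^2)=(x+1)g(x^2)$. If $G*Q^{2k+1}\in\mathcal{H}_{2k+1}^\star$, then $F*G\in\mathcal{H}_{2k+1}^\star$ for every $F\in\mathcal{H}_{2k+1}^\star$.
   Context: $\mathbb{R}_n^+$ denotes the set of real polynomials of degree $n$ all of whose coefficients (of $x^0,\dots,x^n$) are positive. $\mathcal{H}_n^\star$ is the set of real polynomials $f(x)=\sum_{i=0}^n a_ix^i$ with $a_0,a_n>0$, $a_i\ge 0$ for $1\le i\le n-1$, all of whose complex zeros $z$ satisfy $\Re(z)\le 0$. The Hadamard product of $f(x)=\sum_{i=0}^n a_ix^i$ and $g(x)=\sum_{i=0}^m b_ix^i$ is $(f*g)(x)=\sum_{i=0}^{\min\{n,m\}}a_ib_ix^i$. $Q^{2k+1}(x)=(x^2+1)^k+x(x^2+1)^k$. *)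

theory Defs
  imports Complex_Main "HOL-Computational_Algebra.Computational_Algebra"
begin

definition positive_polys :: "nat \<Rightarrow> real poly set" where
  "positive_polys n = {f. degree f = n \<and> (\<forall>i\<le>n. coeff f i > 0)}"

definition quasi_stable_polys :: "nat \<Rightarrow> real poly set" where
  "quasi_stable_polys n =
     {f. degree f = n \<and> coeff f 0 > 0 \<and> coeff f n > 0 \<and> (\<forall>i\<in>{1..<n}. coeff f i \<ge> 0) \<and>
         (\<forall>z :: complex. poly (map_poly complex_of_real f) z = 0 \<longrightarrow> Re z \<le> 0)}"

definition hadamard_prod :: "real poly \<Rightarrow> real poly \<Rightarrow> real poly" where
  "hadamard_prod f g = (\<Sum>i = 0..min (degree f) (degree g). monom (coeff f i * coeff g i) i)"

(* Indexed by k, not by the degree: Q_odd k is the polynomial Q^(2k+1). *)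
definition Q_odd :: "nat \<Rightarrow> real poly" where
  "Q_odd k = (monom 1 2 + 1) ^ k + monom 1 1 * (monom 1 2 + 1) ^ k"

end

theory Submission
  imports Defs
begin

text \<open>Write \<open>F = E(x\<^sup>2) + x O(x\<^sup>2)\<close>. Freezing \<open>x\<close> in the open first quadrant, \<open>E(w) + x O(w)\<close> has no
  zeros in the upper half-plane. The hypothesis on \<open>Q\<close> says that \<open>h(w) = \<Sum>i. (k choose i) g\<^sub>i w\<^sup>i\<close> has
  only negative zeros, so by the half-plane version of the Schur--Szego composition theorem
  \<open>(E * g)(w) + x (O * g)(w)\<close> has no zeros in the upper half-plane either; taking \<open>w = x\<^sup>2\<close> shows
  that \<open>F * G\<close> does not vanish in the first quadrant. Conjugation and positivity of the
  coefficients cover the rest of the right half-plane.\<close>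

section \<open>Root induction and Hermite-Biehler stability\<close>

text \<open>Lets the norm bound and the logarithmic-derivative bound below be checked one linear
  factor at a time.\<close>

lemma poly_root_factor_induct [consumes 1, case_names const factor]:
  fixes p :: "complex poly"
  assumes "p \<noteq> 0"
    and "\<And>c. c \<noteq> 0 \<Longrightarrow> P [:c:]"
    and "\<And>z p. p \<noteq> 0 \<Longrightarrow> P p \<Longrightarrow> P ([:- z, 1:] * p)"
  shows "P p"
  using assms(1)
proof (induction "degree p" arbitrary: p)
  case 0
  then obtain c where "p = [:c:]" by (metis degree_eq_zeroE)
  then show ?case using 0 assms(2) by auto
next
  case (Suc n)
  then obtain z where "poly p z = 0"
    using alg_closed_imp_poly_has_root[of p] by auto
  then obtain q where q: "p = [:- z, 1:] * q" by (metis dvdE poly_eq_0_iff_dvd)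
  with Suc.prems have "q \<noteq> 0" by auto
  moreover from this have "degree p = Suc (degree q)"
    unfolding q by (subst degree_mult_eq) auto
  ultimately show ?case using Suc.hyps q assms(3) by auto
qed

text \<open>A root in the closed left half-plane is at least as close to the mirror image
  \<open>- cnj s\<close> as to \<open>s\<close>; these comparisons are multiplied over all
  roots.\<close>

lemma norm_poly_reflect_le:
  fixes p :: "complex poly"
  assumes "p \<noteq> 0" "\<And>z. poly p z = 0 \<Longrightarrow> Re z \<le> 0" "Re s \<ge> 0"
  shows "norm (poly p (- cnj s)) \<le> norm (poly p s)"
  using assms(1,2)
proof (induction p rule: poly_root_factor_induct)
  case (const c)
  then show ?case by simp
next
  case (factor z p)
  have "Re z \<le> 0" using factor.prems[of z] by simp
  then have "Re s * Re z \<le> 0" using assms(3) by (simp add: mult_nonneg_nonpos)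
  then have "norm (- z - cnj s) \<le> norm (s - z)"
    unfolding cmod_def by (intro real_sqrt_le_mono) (simp add: power2_eq_square algebra_simps)
  moreover have "norm (poly p (- cnj s)) \<le> norm (poly p s)"
    using factor by auto
  ultimately show ?case
    unfolding poly_mult norm_mult by (intro mult_mono) simp_all
qed

lemma sum_even_odd_split:
  fixes c :: "nat \<Rightarrow> 'a :: comm_semiring_1"
  shows "(\<Sum>i\<le>2*k+1. c i * z ^ i) = (\<Sum>i\<le>k. (c (2*i) + z * c (2*i+1)) * (z^2) ^ i)"
  by (induction k) (simp_all add: algebra_simps power_mult[symmetric])

lemma poly_map_poly_of_real_cnj:
  "poly (map_poly complex_of_real f) (cnj z) = cnj (poly (map_poly of_real f) z)"
proof -
  have "map_poly cnj (map_poly complex_of_real f) = map_poly of_real f"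
    by (intro poly_eqI) (simp add: coeff_map_poly)
  then show ?thesis by (metis poly_cnj)
qed

lemma poly_map_poly_of_real:
  assumes "degree f \<le> n"
  shows "poly (map_poly complex_of_real f) z = (\<Sum>i\<le>n. of_real (coeff f i) * z ^ i)"
proof -
  have "degree (map_poly complex_of_real f) \<le> n" using assms by (simp add: degree_map_poly)
  then have "poly (map_poly complex_of_real f) z
      = (\<Sum>i\<le>n. coeff (map_poly complex_of_real f) i * z ^ i)"
    unfolding poly_altdef by (intro sum.mono_neutral_left) (auto simp: coeff_eq_0)
  then show ?thesis by (simp add: coeff_map_poly)
qed

text \<open>The Hermite--Biehler theorem in the form needed here: freezing the odd variable at \<open>x\<close>,
  the identity \<open>2s (E + x O) = (s + x) f(s) + (s - x) f(-s)\<close> reduces the claim to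
  \<open>|f(-s)| \<le> |f(s)|\<close> and \<open>|s - x| < |s + x|\<close>.\<close>

lemma even_plus_odd_nonzero:
  fixes f :: "real poly"
  assumes "f \<noteq> 0" "degree f \<le> 2 * k + 1"
    and roots: "\<And>z. poly (map_poly complex_of_real f) z = 0 \<Longrightarrow> Re z \<le> 0"
    and "Re x > 0" "Im x > 0" "Re s > 0" "Im s > 0"
  shows "(\<Sum>i\<le>k. (of_real (coeff f (2*i)) + x * of_real (coeff f (2*i+1))) * (s^2) ^ i) \<noteq> (0::complex)"
proof
  let ?p = "map_poly complex_of_real f"
  define E where "E = (\<Sum>i\<le>k. complex_of_real (coeff f (2*i)) * (s^2) ^ i)"
  define D where "D = (\<Sum>i\<le>k. complex_of_real (coeff f (2*i+1)) * (s^2) ^ i)"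
  assume "(\<Sum>i\<le>k. (of_real (coeff f (2*i)) + x * of_real (coeff f (2*i+1))) * (s^2) ^ i) = (0::complex)"
  then have ED: "E + x * D = 0"
    by (simp add: E_def D_def sum_distrib_left sum.distrib algebra_simps)
  \<comment> \<open>Used for \<open>t = s\<close> and \<open>t = - s\<close>, which share the same
    \<open>E\<close> and \<open>D\<close>.\<close>
  have val: "poly ?p t = E + t * D" if "t^2 = s^2" for t
    unfolding poly_map_poly_of_real[OF assms(2)] sum_even_odd_split that
    by (simp add: E_def D_def sum_distrib_left sum.distrib algebra_simps)
  have "(s + x) * poly ?p s = (x - s) * poly ?p (- s)"
  proof -
    have "(s + x) * (E + s * D) - (x - s) * (E + (- s) * D) = 2 * s * (E + x * D)"
      by (simp add: algebra_simps)
    then show ?thesis using ED val[of s] val[of "- s"] by simp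
  qed
  then have eq: "norm (s + x) * norm (poly ?p s) = norm (x - s) * norm (poly ?p (- s))"
    by (metis norm_mult)
  have p0: "?p \<noteq> 0" using assms(1) by (simp add: map_poly_eq_0_iff)
  have "poly ?p s \<noteq> 0" using roots[of s] assms(6) by auto
  then have pos: "norm (poly ?p s) > 0" by simp
  \<comment> \<open>Since the coefficients are real, the value at \<open>- s\<close> has the same
    modulus as the value at the mirror image of \<open>s\<close> in the imaginary axis.\<close>
  have "poly ?p (- s) = cnj (poly ?p (- cnj s))"
    by (metis poly_map_poly_of_real_cnj complex_cnj_cnj complex_cnj_minus)
  then have le: "norm (poly ?p (- s)) \<le> norm (poly ?p s)"
    using norm_poly_reflect_le[OF p0 roots, of s] assms by simp
  \<comment> \<open>The squared moduli of \<open>s + x\<close> and \<open>x - s\<close> differ by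
    four times the sum of these two products.\<close>
  have "Re s * Re x > 0" "Im s * Im x > 0" using assms by simp_all
  then have "norm (x - s) < norm (s + x)"
    unfolding cmod_def by (intro real_sqrt_less_mono) (simp add: power2_eq_square algebra_simps)
  then have "norm (x - s) * norm (poly ?p (- s)) < norm (s + x) * norm (poly ?p s)"
    using le pos by (meson mult_left_mono mult_strict_right_mono norm_ge_zero order_le_less_trans)
  with eq show False by simp
qed

section \<open>Laguerre, Grace and Schur-Szego theorems for a half-plane\<close>

text \<open>For a single root \<open>z\<close>, the values \<open>u = 1 / (y - z)\<close> with \<open>Im z \<le> 0\<close> fill the disc
  \<open>Im y |u|\<^sup>2 + Im u \<le> 0\<close>; by convexity the average of \<open>n\<close> such values, some possibly \<open>0\<close>,
  stays in it.\<close>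

lemma log_deriv_in_disc:
  fixes p :: "complex poly"
  assumes "p \<noteq> 0" "\<And>z. poly p z = 0 \<Longrightarrow> Im z \<le> 0" "Im y > 0" "degree p \<le> n"
  shows "Im y * (norm (poly (pderiv p) y / poly p y))\<^sup>2 + n * Im (poly (pderiv p) y / poly p y) \<le> 0"
  using assms(1,2,4)
proof (induction p arbitrary: n rule: poly_root_factor_induct)
  case (const c)
  then show ?case by simp
next
  case (factor z p)
  define u v where "u = poly (pderiv p) y / poly p y" and "v = 1 / (y - z)"
  have z: "Im z \<le> 0" using factor.prems(1)[of z] by simp
  then have yz: "y \<noteq> z" using assms(3) by auto
  have py: "poly p y \<noteq> 0" using factor.prems(1)[of y] assms(3) by auto
  have uv: "poly (pderiv ([:- z, 1:] * p)) y / poly ([:- z, 1:] * p) y = u + v"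
  proof -
    have "pderiv ([:- z, 1:] * p) = [:- z, 1:] * pderiv p + p"
      by (subst pderiv_mult) (simp add: pderiv_pCons)
    then have "poly (pderiv ([:- z, 1:] * p)) y = (y - z) * poly (pderiv p) y + poly p y"
      by (simp only: poly_add poly_mult) (simp add: algebra_simps)
    moreover have "poly ([:- z, 1:] * p) y = (y - z) * poly p y"
      by (simp add: algebra_simps)
    ultimately show ?thesis
      using yz py by (simp add: u_def v_def add_divide_distrib del: mult_pCons_left)
  qed
  have "degree ([:- z, 1:] * p) = Suc (degree p)"
    using factor.hyps by (subst degree_mult_eq) auto
  then obtain m where m: "n = Suc m" "degree p \<le> m"
    using factor.prems(2) by (cases n) auto
  have u: "Im y * (norm u)\<^sup>2 + m * Im u \<le> 0"
    unfolding u_def using factor.IH[OF _ m(2)] factor.prems(1) by auto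
  have "Im v = - (Im y - Im z) * (norm v)\<^sup>2"
    unfolding v_def by (simp add: Im_divide norm_divide power_divide cmod_power2)
  then have v: "Im y * (norm v)\<^sup>2 + Im v \<le> 0"
    using z by (simp add: algebra_simps mult_nonpos_nonneg)
  show ?case
  \<comment> \<open>For \<open>m = 0\<close> there is no average to form, but the bound on
    \<open>u\<close> alone forces \<open>u = 0\<close>.\<close>
  proof (cases "m = 0")
    case True
    then have "u = 0" using u assms(3) by (simp add: mult_le_0_iff)
    then show ?thesis unfolding uv using v m(1) True by simp
  next
    case False
    define a where "a = real m"
    have a: "a > 0" using False by (simp add: a_def)
    \<comment> \<open>This square encodes convexity of the squared norm for the points
      \<open>u / a\<close> and \<open>v\<close> with weights \<open>a / (a + 1)\<close> and
      \<open>1 / (a + 1)\<close>.\<close>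
    have "0 \<le> (norm (u - of_real a * v))\<^sup>2" by simp
    then have "a * (norm (u + v))\<^sup>2 \<le> (a + 1) * ((norm u)\<^sup>2 + a * (norm v)\<^sup>2)"
      unfolding cmod_power2 by (simp add: power2_eq_square algebra_simps)
    then have "Im y * (a * (norm (u + v))\<^sup>2) \<le> Im y * ((a + 1) * ((norm u)\<^sup>2 + a * (norm v)\<^sup>2))"
      using assms(3) by (intro mult_left_mono) auto
    also have "\<dots> = (a + 1) * (Im y * (norm u)\<^sup>2) + (a + 1) * a * (Im y * (norm v)\<^sup>2)"
      by (simp add: algebra_simps)
    also have "\<dots> \<le> (a + 1) * (- a * Im u) + (a + 1) * a * (- Im v)"
      using u v a by (intro add_mono mult_left_mono) (auto simp: a_def)
    finally have "a * (Im y * (norm (u + v))\<^sup>2 + (a + 1) * Im (u + v)) \<le> 0"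
      by (simp add: algebra_simps)
    then have "Im y * (norm (u + v))\<^sup>2 + (a + 1) * Im (u + v) \<le> 0"
      using a by (simp add: mult_le_0_iff)
    then show ?thesis unfolding uv using m(1) by (simp add: a_def add.commute)
  qed
qed

text \<open>The polynomial is \<open>\<gamma>\<close> times the polar derivative of \<open>p\<close>
  with pole \<open>1 / \<gamma>\<close> in the upper half-plane. At a zero \<open>y\<close>,
  \<open>n / u = y - 1 / \<gamma>\<close> would have imaginary part below \<open>Im y\<close>,
  whereas \<open>log_deriv_in_disc\<close> gives at least \<open>Im y\<close>.\<close>

lemma laguerre_half_plane:
  fixes p :: "complex poly"
  assumes "\<And>z. Im z > 0 \<Longrightarrow> poly p z \<noteq> 0" "degree p \<le> n" "n > 0" "Im \<gamma> < 0" "Im y > 0"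
  shows "poly (smult (of_nat n * \<gamma>) p + [:1, - \<gamma>:] * pderiv p) y \<noteq> 0"
proof
  assume zero: "poly (smult (of_nat n * \<gamma>) p + [:1, - \<gamma>:] * pderiv p) y = 0"
  define u where "u = poly (pderiv p) y / poly p y"
  have py: "poly p y \<noteq> 0" using assms by auto
  have g0: "\<gamma> \<noteq> 0" using assms by auto
  have "of_nat n * \<gamma> + (1 - \<gamma> * y) * u = 0"
    using zero py unfolding u_def by (simp add: field_simps)
  then have eq: "\<gamma> * (y * u - of_nat n) = u"
    by (simp add: algebra_simps)
  then have u0: "u \<noteq> 0" using g0 assms(3) by auto
  have "of_nat n / u = y - 1 / \<gamma>"
    using eq u0 g0 by (simp add: field_simps)
  then have "Im (of_nat n / u) = Im y + Im \<gamma> / (norm \<gamma>)\<^sup>2"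
    by (simp add: Im_divide cmod_power2)
  moreover have "Im \<gamma> / (norm \<gamma>)\<^sup>2 < 0" using assms(4) g0 by (simp add: divide_neg_pos)
  moreover have "Im (of_nat n / u) = - (real n * Im u / (norm u)\<^sup>2)"
    by (simp add: Im_divide cmod_power2)
  moreover have "Im y * (norm u)\<^sup>2 + n * Im u \<le> 0"
    unfolding u_def
  proof (rule log_deriv_in_disc)
    show "Im z \<le> 0" if "poly p z = 0" for z using assms(1)[of z] that by linarith
  qed (use assms py in auto)
  then have "Im y \<le> - (real n * Im u / (norm u)\<^sup>2)"
    using u0 by (simp add: field_simps)
  ultimately show False by simp
qed

text \<open>Splitting off one root \<open>- \<gamma>\<close> of \<open>q\<close> turns the pairing of \<open>p\<close> with \<open>q\<close> into the pairing of
  the polar derivative of \<open>p\<close> with the cofactor, so the claim follows by iterating Laguerre's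
  theorem.\<close>

lemma grace_half_plane:
  fixes p q :: "complex poly"
  assumes "\<And>z. Im z > 0 \<Longrightarrow> poly p z \<noteq> 0" "degree p \<le> n"
    and "degree q = n" "q \<noteq> 0" "\<And>z. poly q z = 0 \<Longrightarrow> Im z > 0"
  shows "(\<Sum>i\<le>n. coeff p i * coeff q i / of_nat (n choose i)) \<noteq> 0"
  using assms
proof (induction n arbitrary: p q)
  case 0
  then obtain c d where "p = [:c:]" "q = [:d:]" by (metis degree_eq_zeroE le_zero_eq)
  then show ?case using 0(1)[of \<i>] 0(4) by simp
next
  case (Suc n)
  obtain z where z: "poly q z = 0"
    using alg_closed_imp_poly_has_root[of q] Suc.prems by auto
  then obtain r where r: "q = [:- z, 1:] * r" by (metis dvdE poly_eq_0_iff_dvd)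
  with Suc.prems have r0: "r \<noteq> 0" by auto
  have deg: "degree r = n"
    using Suc.prems(3) r0 unfolding r by (subst (asm) degree_mult_eq) auto
  define \<gamma> where "\<gamma> = - z"
  have g: "Im \<gamma> < 0" using Suc.prems(5)[OF z] by (simp add: \<gamma>_def)
  define R where "R = smult (of_nat (Suc n) * \<gamma>) p + [:1, - \<gamma>:] * pderiv p"
  have R: "coeff R i = \<gamma> * (of_nat (Suc n) - of_nat i) * coeff p i + of_nat (Suc i) * coeff p (Suc i)" for i
    unfolding R_def by (cases i) (simp_all add: coeff_pderiv coeff_pCons algebra_simps)
  have "degree R \<le> n"
  proof (intro degree_le allI impI)
    fix i assume i: "n < i"
    then have "coeff p (Suc i) = 0" using Suc.prems(2) by (simp add: coeff_eq_0)
    \<comment> \<open>At \<open>i = Suc n\<close> the factor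
      \<open>of_nat (Suc n) - of_nat i\<close> vanishes, which is why the polar derivative loses a
      degree.\<close>
    moreover have "i = Suc n \<or> coeff p i = 0"
      using i Suc.prems(2) by (metis Suc_lessI coeff_eq_0 le_less_trans)
    ultimately show "coeff R i = 0" unfolding R by auto
  qed
  moreover have "poly R y \<noteq> 0" if "Im y > 0" for y
    unfolding R_def using Suc.prems g that by (intro laguerre_half_plane) auto
  ultimately have nz: "(\<Sum>i\<le>n. coeff R i * coeff r i / of_nat (n choose i)) \<noteq> 0"
    using deg r0 Suc.prems(5) r by (intro Suc.IH) auto
  \<comment> \<open>The two parts of \<open>q\<close>, from \<open>\<gamma>\<close> times
    \<open>r\<close> and from the variable times \<open>r\<close>; the index in \<open>B\<close> is
    shifted so that both carry \<open>coeff r i\<close>.\<close>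
  define A B :: "nat \<Rightarrow> complex" where
    "A = (\<lambda>i. coeff p i * \<gamma> * coeff r i / of_nat (Suc n choose i))" and
    "B = (\<lambda>i. coeff p (Suc i) * coeff r i / of_nat (Suc n choose Suc i))"
  have "(\<Sum>i\<le>Suc n. coeff p i * coeff q i / of_nat (Suc n choose i))
      = (\<Sum>i\<le>Suc n. A i) + (\<Sum>i\<le>n. B i)"
  proof -
    have "(\<Sum>i\<le>Suc n. coeff p i * coeff q i / of_nat (Suc n choose i))
       = (\<Sum>i\<le>Suc n. A i + (if i = 0 then 0 else B (i - 1)))"
    proof (intro sum.cong refl)
      fix i
      show "coeff p i * coeff q i / of_nat (Suc n choose i) = A i + (if i = 0 then 0 else B (i - 1))"
        unfolding A_def B_def r \<gamma>_def
        by (cases i) (simp_all add: algebra_simps add_divide_distrib diff_divide_distrib)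
    qed
    also have "\<dots> = (\<Sum>i\<le>Suc n. A i) + (\<Sum>i\<le>n. B i)"
      unfolding sum.distrib by (subst (2) sum.atMost_Suc_shift) simp
    finally show ?thesis .
  qed
  also have "(\<Sum>i\<le>Suc n. A i) = (\<Sum>i\<le>n. A i)"
    using deg by (simp add: A_def coeff_eq_0)
  also have "(\<Sum>i\<le>n. A i) + (\<Sum>i\<le>n. B i)
      = (\<Sum>i\<le>n. coeff R i * coeff r i / of_nat (n choose i)) / of_nat (Suc n)"
    unfolding sum.distrib[symmetric] sum_divide_distrib
  proof (intro sum.cong refl)
    fix i assume "i \<in> {..n}"
    then have i: "i \<le> n" by simp
    define N C1 C2 C :: complex where "N = of_nat (Suc n)" and "C1 = of_nat (Suc n choose i)"
      and "C2 = of_nat (Suc n choose Suc i)" and "C = of_nat (n choose i)"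
    have nz': "N \<noteq> 0" "C1 \<noteq> 0" "C2 \<noteq> 0" "C \<noteq> 0"
      using i by (auto simp: N_def C1_def C2_def C_def binomial_eq_0_iff simp del: of_nat_Suc binomial_Suc_Suc)
    \<comment> \<open>The two absorption identities bring both reciprocal binomials to the common
      denominator \<open>C * N\<close>, and the numerators are exactly the weights in
      \<open>R\<close>.\<close>
    have "(Suc n - i) * (Suc n choose i) = Suc n * (n choose i)"
      using binomial_absorb_comp[of "Suc n" i] by simp
    then have "of_nat ((Suc n - i) * (Suc n choose i)) = (of_nat (Suc n * (n choose i)) :: complex)"
      by (rule arg_cong)
    then have c1: "(N - of_nat i) * C1 = N * C"
      using i unfolding of_nat_mult N_def C1_def C_def by (simp add: of_nat_diff)
    have "of_nat (Suc i * (Suc n choose Suc i)) = (of_nat (Suc n * (n choose i)) :: complex)"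
      by (rule arg_cong, rule Suc_times_binomial)
    then have c2: "of_nat (Suc i) * C2 = N * C"
      unfolding of_nat_mult N_def C2_def C_def .
    have 1: "1 / C1 = (N - of_nat i) / (C * N)" using c1 nz' by (simp add: field_simps)
    have 2: "1 / C2 = of_nat (Suc i) / (C * N)" using c2 nz' by (simp add: field_simps)
    have "A i + B i = coeff p i * \<gamma> * coeff r i * (1 / C1) + coeff p (Suc i) * coeff r i * (1 / C2)"
      unfolding A_def B_def C1_def C2_def by simp
    also have "\<dots> = coeff R i * coeff r i / C / N"
      unfolding 1 2 R N_def[symmetric] using nz' by (simp add: field_simps)
    finally show "A i + B i = coeff R i * coeff r i / of_nat (n choose i) / of_nat (Suc n)"
      unfolding C_def N_def .
  qed
  finally show ?case using nz by (simp del: of_nat_Suc)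
qed

text \<open>Grace's theorem is applied to \<open>p\<close> and \<open>h(w z)\<close>, whose zeros
  are negative reals divided by \<open>w\<close> and hence lie in the upper half-plane.\<close>

lemma szego_half_plane:
  fixes p h :: "complex poly"
  assumes "\<And>z. Im z > 0 \<Longrightarrow> poly p z \<noteq> 0" "degree p \<le> n"
    and "degree h = n" "h \<noteq> 0" "\<And>z. poly h z = 0 \<Longrightarrow> Im z = 0 \<and> Re z < 0" "Im w > 0"
  shows "(\<Sum>i\<le>n. coeff p i * (coeff h i / of_nat (n choose i)) * w ^ i) \<noteq> 0"
proof -
  have w0: "w \<noteq> 0" using assms by auto
  define q where "q = pcompose h [:0, w:]"
  have "(\<Sum>i\<le>n. coeff p i * coeff q i / of_nat (n choose i)) \<noteq> 0"
  proof (rule grace_half_plane)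
    show "degree q = n" using assms w0 by (simp add: q_def degree_pcompose)
    show "q \<noteq> 0" using assms w0 by (simp add: q_def pcompose_eq_0_iff)
    fix z assume "poly q z = 0"
    then have "poly h (w * z) = 0" by (simp add: q_def poly_pcompose mult.commute)
    then have *: "Im (w * z) = 0" "Re (w * z) < 0" using assms(5) by blast+
    have "z = (w * z) / w" using w0 by simp
    also have "Im \<dots> = - (Re (w * z) * Im w) / (norm w)\<^sup>2"
      using * by (simp only: Im_divide cmod_power2) simp
    also have "\<dots> > 0"
      using * assms(6) w0 by (intro divide_pos_pos) (auto intro: mult_neg_pos simp del: times_complex.sel)
    finally show "Im z > 0" .
  qed (use assms in auto)
  then show ?thesis by (simp add: q_def mult_ac coeff_pcompose_linear)
qed

section \<open>Coefficients of the polynomials involved\<close>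

lemma coeff_hadamard_prod [simp]: "coeff (hadamard_prod f g) i = coeff f i * coeff g i"
proof -
  have "coeff (hadamard_prod f g) i
      = (if i \<in> {0..min (degree f) (degree g)} then coeff f i * coeff g i else 0)"
    unfolding hadamard_prod_def coeff_sum coeff_monom by (rule sum.delta) simp
  then show ?thesis by (auto simp: coeff_eq_0)
qed

lemma coeff_pcompose_square:
  fixes g :: "'a :: comm_semiring_1 poly"
  shows
  "coeff (pcompose g (monom 1 2)) i = (if even i then coeff g (i div 2) else 0)"
proof (induction g arbitrary: i)
  case (pCons a g)
  show ?case
    by (auto simp: pcompose_pCons coeff_monom_mult coeff_pCons pCons.IH split: nat.split)
       (auto elim!: evenE oddE)
qed simp

lemma coeff_even_odd_double:
  fixes g :: "real poly"
  assumes "G = pcompose g (monom 1 2) + monom 1 1 * pcompose g (monom 1 2)"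
  shows "coeff G i = coeff g (i div 2)"
  unfolding assms coeff_add coeff_monom_mult coeff_pcompose_square by (cases i) auto

text \<open>\<open>Q_odd k\<close> arises from \<open>(1 + x) ^ k\<close> in the same way as
  \<open>G\<close> from \<open>g\<close>.\<close>

lemma coeff_Q_odd: "coeff (Q_odd k) i = real (k choose (i div 2))"
proof -
  have "(monom 1 2 + 1) ^ k = pcompose ([:1, 1:] ^ k) (monom 1 2 :: real poly)"
  proof (induction k)
    case (Suc k)
    have "monom 1 2 + 1 = pcompose [:1, 1:] (monom 1 2 :: real poly)"
      by (simp add: pcompose_pCons one_pCons add.commute)
    with Suc show ?case by (simp only: power_Suc pcompose_mult)
  qed (simp add: pcompose_1)
  then have "coeff (Q_odd k) i = coeff ([:1, 1:] ^ k) (i div 2)"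
    unfolding Q_odd_def by (intro coeff_even_odd_double) simp
  then show ?thesis
    by (cases "i div 2 \<le> k") (simp_all add: coeff_linear_poly_power coeff_eq_0 degree_linear_power)
qed

section \<open>Quasi-stability of the Hadamard product\<close>

theorem theorem10:
  fixes k :: nat and g G :: "real poly"
  assumes "k \<ge> 1"
    and "g \<in> positive_polys k"
    and "G = pcompose g (monom 1 2) + monom 1 1 * pcompose g (monom 1 2)"
    and "hadamard_prod G (Q_odd k) \<in> quasi_stable_polys (2 * k + 1)"
  shows "\<forall>F \<in> quasi_stable_polys (2 * k + 1). hadamard_prod F G \<in> quasi_stable_polys (2 * k + 1)"
proof
  fix F assume F: "F \<in> quasi_stable_polys (2 * k + 1)"
  have G: "coeff G i = coeff g (i div 2)" for i
    by (rule coeff_even_odd_double[OF assms(3)])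
  have g: "degree g = k" "\<And>i. i \<le> k \<Longrightarrow> coeff g i > 0"
    using assms(2) by (auto simp: positive_polys_def)
  have degF: "degree F = 2 * k + 1" and F0: "coeff F 0 > 0" and Flead: "coeff F (2 * k + 1) > 0"
    and Froots: "\<And>z. poly (map_poly complex_of_real F) z = 0 \<Longrightarrow> Re z \<le> 0"
    using F by (auto simp: quasi_stable_polys_def)
  have Fnn: "coeff F i \<ge> 0" for i
  proof -
    have "i = 0 \<or> i = 2 * k + 1 \<or> i \<in> {1..<2 * k + 1} \<or> i > 2 * k + 1" by auto
    then show ?thesis
      using F by (auto simp: quasi_stable_polys_def coeff_eq_0 less_imp_le)
  qed

  \<comment> \<open>The binomial weights come from \<open>Q_odd k\<close>; the division in
    \<open>szego_half_plane\<close> cancels them and leaves the coefficients of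
    \<open>g\<close>.\<close>
  define h where "h = (\<Sum>i\<le>k. monom (complex_of_real (coeff g i * real (k choose i))) i)"
  have h: "coeff h i = of_real (coeff g i) * of_nat (k choose i)" for i
    using g(1) by (simp add: h_def coeff_sum coeff_eq_0)
  have deg_h: "degree h = k"
  proof (rule antisym)
    show "degree h \<le> k" by (intro degree_le) (simp add: h)
    show "k \<le> degree h" using g(2)[of k] by (intro le_degree) (simp add: h)
  qed
  have "coeff h 0 \<noteq> 0" using g(2)[of 0] by (simp add: h)
  have GQ: "poly (map_poly complex_of_real (hadamard_prod G (Q_odd k))) s = (1 + s) * poly h (s\<^sup>2)" for s
  proof -
    have "degree (hadamard_prod G (Q_odd k)) \<le> 2 * k + 1"
      using assms(4) by (simp add: quasi_stable_polys_def)
    from poly_map_poly_of_real[OF this] show ?thesis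
      unfolding sum_even_odd_split poly_altdef[of h] deg_h sum_distrib_left
      by (simp add: G coeff_Q_odd h algebra_simps)
  qed
  have h_roots: "Im z = 0 \<and> Re z < 0" if z: "poly h z = 0" for z
  proof -
    \<comment> \<open>Both square roots of \<open>z\<close> are zeros of the product with
      \<open>Q_odd k\<close>. Being opposite, they must be purely imaginary, so \<open>z\<close> is
      real and nonpositive; \<open>coeff h 0\<close> being nonzero then excludes 0.\<close>
    have "Re s \<le> 0" if "s\<^sup>2 = z" for s
      using assms(4) GQ[of s] that z by (simp add: quasi_stable_polys_def)
    from this[of "csqrt z"] this[of "- csqrt z"] have "Re (csqrt z) = 0" by simp
    moreover have "z = (csqrt z)\<^sup>2" by simp
    ultimately have "Im z = 0" "Re z = - (Im (csqrt z))\<^sup>2"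
      by (metis Im_power2 mult_zero_left mult_zero_right, metis Re_power2 diff_0 power_zero_numeral)
    moreover have "z \<noteq> 0" using z \<open>coeff h 0 \<noteq> 0\<close> by (auto simp: poly_0_coeff_0)
    ultimately show ?thesis
      by (metis complex_eq_iff zero_complex.sel neg_le_0_iff_le zero_le_power2 order_le_less)
  qed

  let ?H = "hadamard_prod F G"
  have degH: "degree ?H = 2 * k + 1"
  proof (rule antisym)
    show "degree ?H \<le> 2 * k + 1" by (intro degree_le) (simp add: degF coeff_eq_0)
    show "2 * k + 1 \<le> degree ?H" using Flead g(2)[of k] by (intro le_degree) (simp add: G)
  qed
  have Hnn: "coeff ?H i \<ge> 0" if "i \<le> 2 * k + 1" for i
    using Fnn[of i] g(2)[of "i div 2"] that by (simp add: G less_imp_le)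
  have H0: "coeff ?H 0 > 0" using F0 g(2)[of 0] by (simp add: G)
  have H: "poly (map_poly complex_of_real ?H) z = (\<Sum>i\<le>2*k+1. of_real (coeff ?H i) * z ^ i)" for z
    by (rule poly_map_poly_of_real) (simp add: degH)

  have first_quadrant: "poly (map_poly complex_of_real ?H) x \<noteq> 0" if x: "Re x > 0" "Im x > 0" for x
  proof -
    \<comment> \<open>The factor \<open>x\<close> in front of the odd part is frozen, while the
      variable standing for its square stays free until it is set to
      \<open>x\<^sup>2\<close>.\<close>
    define p where "p = (\<Sum>i\<le>k. monom (of_real (coeff F (2*i)) + x * of_real (coeff F (2*i+1))) i)"
    have p: "coeff p i = (if i \<le> k then of_real (coeff F (2*i)) + x * of_real (coeff F (2*i+1)) else 0)" for i
      by (simp add: p_def coeff_sum)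
    have "(\<Sum>i\<le>k. coeff p i * (coeff h i / of_nat (k choose i)) * (x\<^sup>2) ^ i) \<noteq> 0"
    proof (rule szego_half_plane)
      fix w :: complex assume w: "Im w > 0"
      have csqrt: "Im (csqrt w) > 0" "Re (csqrt w) > 0"
      proof -
        \<comment> \<open>The real and imaginary parts of the root have the same sign, and the
          principal root has nonnegative real part.\<close>
        have "Im ((csqrt w)\<^sup>2) > 0" using w by simp
        then have "Re (csqrt w) * Im (csqrt w) > 0" by (simp only: Im_power2 zero_less_mult_iff) auto
        then show "Im (csqrt w) > 0" "Re (csqrt w) > 0"
          using Re_csqrt[of w] by (auto simp del: csqrt.sel simp: zero_less_mult_iff)
      qed
      have "F \<noteq> 0" using F0 by auto
      from even_plus_odd_nonzero[OF this _ Froots x csqrt(2,1), where k = k] degF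
      show "poly p w \<noteq> 0" by (auto simp: p_def poly_sum poly_monom)
    next
      show "degree p \<le> k" by (intro degree_le) (simp add: p)
      show "Im (x\<^sup>2) > 0" using x by (simp add: Im_power2)
    qed (use \<open>coeff h 0 \<noteq> 0\<close> deg_h h_roots in auto)
    also have "(\<Sum>i\<le>k. coeff p i * (coeff h i / of_nat (k choose i)) * (x\<^sup>2) ^ i)
        = poly (map_poly complex_of_real ?H) x"
      unfolding H sum_even_odd_split
      by (intro sum.cong refl) (simp add: p h G algebra_simps)
    finally show ?thesis .
  qed
  have "Re z \<le> 0" if z: "poly (map_poly complex_of_real ?H) z = 0" for z
  proof (rule ccontr)
    assume "\<not> Re z \<le> 0"
    then have Re: "Re z > 0" by simp
    consider "Im z > 0" | "Im z < 0" | "Im z = 0" by linarith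
    then show False
    proof cases
      case 1
      then show ?thesis using first_quadrant Re z by blast
    next
      case 2
      then show ?thesis using first_quadrant[of "cnj z"] Re z
        by (simp add: poly_map_poly_of_real_cnj)
    next
      case 3
      then have zr: "z = of_real (Re z)" by (simp add: complex_eq_iff)
      \<comment> \<open>On the positive axis nonnegative coefficients with a positive constant term
        give a positive value.\<close>
      have "complex_of_real (\<Sum>i\<le>2*k+1. coeff ?H i * Re z ^ i) = 0"
        using z unfolding H by (subst (asm) zr) simp
      then have "(\<Sum>i\<le>2*k+1. coeff ?H i * Re z ^ i) = 0"
        using of_real_eq_0_iff by blast
      moreover have "(\<Sum>i\<le>2*k+1. coeff ?H i * Re z ^ i) > 0"
        using Hnn Re H0 by (intro sum_pos2[of _ 0]) (auto intro!: mult_nonneg_nonneg simp del: coeff_hadamard_prod)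
      ultimately show False by simp
    qed
  qed
  moreover have "coeff ?H (2 * k + 1) > 0" using Flead g(2)[of k] by (simp add: G)
  ultimately show "?H \<in> quasi_stable_polys (2 * k + 1)"
    using degH H0 Hnn by (auto simp: quasi_stable_polys_def simp del: coeff_hadamard_prod)
qed

end
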